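(* Let $w \in \mathbb{N}^*$. Then the words in the $\equiv_{\mathrm{mTg}}$-class $[w]_{\mathrm{mTg}}$ of $w$ are in bijection with the linear extensions of the poset $Q[X;T_L;T_R]$, where $(T_L,T_R) = \mathrm{P}_{\mathrm{mTg}}(w)$, $\mathrm{supp}(w) = \{x_1 < \cdots < x_k\}$, and $X \in \mathbb{N}^k$ is such that $X_i = |w|_{x_i}$.
   Context: $\mathbb{N}=\{1,2,\dots\}$ and $\mathbb{N}^*$ is the set of words over $\mathbb{N}$. $|w|_x$ is the number of occurrences of $x$ in $w$; $\mathrm{supp}(w)$ is the set of letters occurring in $w$. Binary trees are rooted planar binary trees; the $i$-th node is the $i$-th node in the inorder traversal. A binary search tree with multiplicities (BSTM) is a binary tree whose nodes are labelled by pairwise distinct letters of $\mathbb{N}$ forming a binary search tree (left subtree letters strictly smaller, right subtree letters strictly greater), each node also carrying a positive integer multiplicity. Inserting a letter $a$ into a BSTM: if a node has letter $a$, increase its multiplicity by 1; otherwise add a new leaf with letter $a$ and multiplicity 1 in the usual binary search tree position. $\mathrm{P}^{\to}_{\mathrm{lTg}}(w)$ (resp. $\mathrm{P}^{\leftarrow}_{\mathrm{rTg}}(w)$) is obtained from the empty tree by inserting the letters of $w$ one by one, reading $w$ left to right (resp. right to left), and $\mathrm{P}_{\mathrm{mTg}}(w)=(\mathrm{P}^{\to}_{\mathrm{lTg}}(w),\mathrm{P}^{\leftarrow}_{\mathrm{rTg}}(w))$. The meet-taiga congruence is given by $u\equiv_{\mathrm{mTg}}v$ iff $\mathrm{P}_{\mathrm{mTg}}(u)=\mathrm{P}_{\mathrm{mTg}}(v)$.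 For a binary tree $T$ with $k$ nodes, $\Delta(T)$ (resp. $\nabla(T)$) is the partial order on $\{1,\dots,k\}$ with $i\le j$ iff the $i$-th node is equal to or an ancestor (resp. a descendant) of the $j$-th node of $T$. $Q[X;T_L;T_R]$ is the poset built by taking $k$ disjoint chains, the $i$-th having $X_i$ elements, and requiring the least (resp. greatest) element of the $i$-th chain to be less than the least (resp. greatest) element of the $j$-th chain whenever $i<j$ in $\Delta(T_L)$ (resp. $\nabla(T_R)$); the order is generated by these relations. A linear extension of a poset is a total order on the same underlying set containing the given partial order. *)

theory Defs
  imports "HOL-Library.Tree" "HOL-Library.Sublist"
begin

text \<open>
  The alphabet is the set of positive integers, so words are the lists in \<open>lists {1..}\<close>.
\<close>

abbreviation words :: "nat list set" where
  "words \<equiv> lists {1..}"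


text \<open>
  A node of a binary search tree with multiplicities is labelled by a pair
  (letter, multiplicity).
\<close>

type_synonym bstm = "(nat \<times> nat) tree"

fun insert_letter :: "nat \<Rightarrow> bstm \<Rightarrow> bstm" where
  "insert_letter a \<langle>\<rangle> = \<langle>\<langle>\<rangle>, (a, 1), \<langle>\<rangle>\<rangle>"
| "insert_letter a \<langle>l, (b, m), r\<rangle> =
     (if a = b then \<langle>l, (b, m + 1), r\<rangle>
      else if a < b then \<langle>insert_letter a l, (b, m), r\<rangle>
      else \<langle>l, (b, m), insert_letter a r\<rangle>)"

definition P_lTg :: "nat list \<Rightarrow> bstm" where
  "P_lTg w = fold insert_letter w \<langle>\<rangle>"

definition P_rTg :: "nat list \<Rightarrow> bstm" where
  "P_rTg w = fold insert_letter (rev w) \<langle>\<rangle>"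

definition P_mTg :: "nat list \<Rightarrow> bstm \<times> bstm" where
  "P_mTg w = (P_lTg w, P_rTg w)"

definition mTg_cong :: "(nat list \<times> nat list) set" where
  "mTg_cong = {(u, v). u \<in> words \<and> v \<in> words \<and> P_mTg u = P_mTg v}"

definition mTg_class :: "nat list \<Rightarrow> nat list set" where
  "mTg_class w = mTg_cong `` {w}"


text \<open>
  Nodes are identified with their addresses, i.e. the paths leading to them from the root
  (\<open>False\<close> = left, \<open>True\<close> = right); being an ancestor or equal is then the prefix order.
\<close>

fun inorder_nodes :: "'a tree \<Rightarrow> bool list list" where
  "inorder_nodes \<langle>\<rangle> = []"
| "inorder_nodes \<langle>l, _, r\<rangle> =
     map ((#) False) (inorder_nodes l) @ [[]] @ map ((#) True) (inorder_nodes r)"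

text \<open>Nodes are numbered from 1, lists from 0.\<close>

definition ith_node :: "'a tree \<Rightarrow> nat \<Rightarrow> bool list" where
  "ith_node T i = inorder_nodes T ! (i - 1)"

definition Delta :: "'a tree \<Rightarrow> (nat \<times> nat) set" where
  "Delta T = {(i, j). i \<in> {1..size T} \<and> j \<in> {1..size T} \<and> prefix (ith_node T i) (ith_node T j)}"

definition Nabla :: "'a tree \<Rightarrow> (nat \<times> nat) set" where
  "Nabla T = {(i, j). i \<in> {1..size T} \<and> j \<in> {1..size T} \<and> prefix (ith_node T j) (ith_node T i)}"


text \<open>
  The poset \<open>Q[X; T\<^sub>L; T\<^sub>R]\<close>, for a list \<open>X\<close> of \<open>k\<close> positive integers and trees \<open>T\<^sub>L\<close>, \<open>T\<^sub>R\<close>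
  with \<open>k\<close> nodes each. The pair \<open>(i, a)\<close> is the \<open>a\<close>-th smallest element of the \<open>i\<close>-th chain,
  with \<open>i\<close> and \<open>a\<close> counted from 1, so that the \<open>i\<close>-th chain has least element \<open>(i, 1)\<close> and
  greatest element \<open>(i, X ! (i - 1))\<close>. Antisymmetry of \<open>Q_order\<close> is not built in: it depends on
  the trees being compatible, and it holds as soon as some linear extension exists.
\<close>

definition Q_carrier :: "nat list \<Rightarrow> (nat \<times> nat) set" where
  "Q_carrier X = {(i, a). i \<in> {1..length X} \<and> a \<in> {1..X ! (i - 1)}}"

definition Q_chains :: "nat list \<Rightarrow> ((nat \<times> nat) \<times> (nat \<times> nat)) set" where
  "Q_chains X = {((i, a), (i, b)) | i a b. (i, a) \<in> Q_carrier X \<and> (i, b) \<in> Q_carrier X \<and> a \<le> b}"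

definition Q_order :: "nat list \<Rightarrow> 'a tree \<Rightarrow> 'b tree \<Rightarrow> ((nat \<times> nat) \<times> (nat \<times> nat)) set" where
  "Q_order X TL TR =
     (Q_chains X
      \<union> {((i, 1), (j, 1)) | i j. (i, j) \<in> Delta TL \<and> i \<noteq> j}
      \<union> {((i, X ! (i - 1)), (j, X ! (j - 1))) | i j. (i, j) \<in> Nabla TR \<and> i \<noteq> j})\<^sup>+"

definition linear_extensions :: "'a set \<Rightarrow> ('a \<times> 'a) set \<Rightarrow> ('a \<times> 'a) set set" where
  "linear_extensions A r = {s. linear_order_on A s \<and> r \<subseteq> s}"

end

theory Submission
  imports Defs
begin

text \<open>
  Inserting \<open>c # w\<close> produces a tree with root \<open>c\<close> whose subtrees are the trees of the subwords of
  letters below and above \<open>c\<close>. By induction, a word \<open>u\<close> with the same content as \<open>w\<close> yields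
  the same left tree as \<open>w\<close> iff in \<open>u\<close> the first occurrence of every letter comes before the
  first occurrences of its descendants in that tree. The right tree is the left tree of the
  reversed word, so it constrains the last occurrences instead. Numbering the occurrences
  of each letter turns a word with the right content into a listing of the elements of the poset that
  respects the chains, and the two conditions on occurrences are the remaining relations of the poset.
\<close>

section \<open>Linear orders on a finite set as lists\<close>

text \<open>Reflexive, as \<open>linear_order_on\<close> demands. A repeated entry can break
  antisymmetry, hence the \<open>distinct\<close> hypotheses that follow.\<close>

fun list_order :: "'a list \<Rightarrow> ('a \<times> 'a) set" where
  "list_order [] = {}"
| "list_order (a # L) = {a} \<times> set (a # L) \<union> list_order L"

lemma list_order_subset: "list_order L \<subseteq> set L \<times> set L"
  by (induction L) auto

lemma list_order_snoc: "list_order (L @ [a]) = list_order L \<union> insert a (set L) \<times> {a}"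
  by (induction L) auto

lemma refl_list_order: "refl_on (set L) (list_order L)"
  by (induction L) (auto simp: refl_on_def)

lemma linear_order_on_list_order:
  assumes "distinct L"
  shows "linear_order_on (set L) (list_order L)"
  using assms
proof (induction L)
  case (Cons a L)
  then have IH: "trans (list_order L)" "antisym (list_order L)" "total_on (set L) (list_order L)"
    and a: "a \<notin> set L"
    by (auto simp: order_on_defs)
  have "trans (list_order (a # L))"
  proof (rule transI)
    fix p q r assume pq: "(p, q) \<in> list_order (a # L)" and qr: "(q, r) \<in> list_order (a # L)"
    have r: "r \<in> set (a # L)"
      using qr list_order_subset[of "a # L"] by blast
    show "(p, r) \<in> list_order (a # L)"
    proof (cases "p = a")
      case False
      then have "(p, q) \<in> list_order L"
        using pq by simp
      moreover from this have "(q, r) \<in> list_order L"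
        using qr a list_order_subset[of L] by auto
      ultimately show ?thesis
        using IH(1) by (auto dest: transD)
    qed (use r in auto)
  qed
  moreover have "antisym (list_order (a # L))"
    using IH(2) a list_order_subset[of L] by (auto simp: antisym_def)
  moreover have "total_on (set (a # L)) (list_order (a # L))"
    using IH(3) by (auto simp: total_on_def)
  ultimately show ?case
    using list_order_subset[of "a # L"] refl_list_order[of "a # L"] by (simp add: order_on_defs)
qed simp

text \<open>The head is the least element of the order, so antisymmetry makes the two heads agree.
  Each tail then carries the restriction of the same order to the remaining elements.\<close>

lemma list_order_inj:
  assumes "distinct L" "distinct M" "set L = set M" "list_order L = list_order M"
  shows "L = M"
  using assms
proof (induction L arbitrary: M)
  case (Cons a L)
  then obtain b M' where M: "M = b # M'"
    by (cases M) auto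
  have anti: "antisym (list_order M)"
    using linear_order_on_list_order[OF Cons.prems(2)] by (simp add: order_on_defs)
  have "b \<in> set (a # L)" "a \<in> set (b # M')"
    using Cons.prems(3) M by auto
  then have "(a, b) \<in> list_order (a # L)" "(b, a) \<in> list_order (b # M')"
    by auto
  then have "(a, b) \<in> list_order M" "(b, a) \<in> list_order M"
    unfolding Cons.prems(4) M by simp_all
  then have ab: "a = b"
    using anti by (auto dest: antisymD)
  have restrict: "list_order K = list_order (c # K) \<inter> set K \<times> set K" if "distinct (c # K)" for c and K :: "'a list"
    using that list_order_subset[of K] by auto
  have set: "set L = set M'"
    using Cons.prems(1-3) unfolding M ab by auto
  have "list_order L = list_order (a # L) \<inter> set L \<times> set L"
    using restrict Cons.prems(1) .
  also have "\<dots> = list_order (b # M') \<inter> set M' \<times> set M'"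
    unfolding Cons.prems(4) M set ..
  also have "\<dots> = list_order M'"
    using restrict[of b M'] Cons.prems(2) unfolding M by simp
  finally have "L = M'"
    using Cons.IH[of M'] Cons.prems(1,2) set M by simp
  then show ?case
    using M ab by simp
qed simp

text \<open>A finite linear order is a well-order: its least element becomes the head of the list.
  The induction ranges over all proper subsets because the order decides which element is
  removed.\<close>

lemma linear_order_on_finite_list:
  assumes "finite A" "linear_order_on A s"
  shows "\<exists>L. distinct L \<and> set L = A \<and> list_order L = s"
  using assms
proof (induction A arbitrary: s rule: finite_psubset_induct)
  case (psubset A)
  show ?case
  proof (cases "A = {}")
    case True
    with psubset.prems show ?thesis
      by (intro exI[of _ "[]"]) (auto simp: order_on_defs)
  next
    case False
    have sA: "s \<subseteq> A \<times> A" and refl: "refl_on A s" and tr: "trans s" and anti: "antisym s"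
      and tot: "total_on A s"
      using psubset.prems by (auto simp: order_on_defs)
    have "finite s"
      using sA psubset.hyps by (meson finite_SigmaI finite_subset)
    then have "wf (s - Id)"
      using psubset.prems linear_order_on_well_order_on well_order_on_def by blast
    with False obtain m where m: "m \<in> A" "\<And>y. (y, m) \<in> s - Id \<Longrightarrow> y \<notin> A"
      by (metis ex_in_conv wfE_min)
    then have least: "(m, y) \<in> s" if "y \<in> A" for y
      using that tot refl unfolding total_on_def refl_on_def by (cases "y = m") auto
    let ?B = "A - {m}"
    let ?t = "s \<inter> ?B \<times> ?B"
    have "linear_order_on ?B ?t"
      using refl tr anti tot
      unfolding order_on_defs refl_on_def trans_def antisym_def total_on_def by blast
    moreover have "?B \<subset> A"
      using m by blast
    ultimately obtain L where L: "distinct L" "set L = ?B" "list_order L = ?t"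
      using psubset.IH[of ?B ?t] by metis
    have "list_order (m # L) = s"
    proof (intro equalityI subrelI)
      fix p q assume "(p, q) \<in> list_order (m # L)"
      then show "(p, q) \<in> s"
        using L least m by auto
    next
      fix p q assume pq: "(p, q) \<in> s"
      then have "q = m \<Longrightarrow> p = m"
        using sA m by blast
      with pq show "(p, q) \<in> list_order (m # L)"
        using L sA by auto
    qed
    then show ?thesis
      using L m by (intro exI[of _ "m # L"]) auto
  qed
qed

text \<open>A linear order is transitive, so it contains \<open>r\<^sup>+\<close> as soon as it
  contains \<open>r\<close>. Hence only the generating relations of the poset have to be checked on
  a list.\<close>

lemma bij_betw_list_order:
  assumes "finite A"
  shows "bij_betw list_order {L. distinct L \<and> set L = A \<and> r \<subseteq> list_order L} (linear_extensions A (r\<^sup>+))"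
proof (rule bij_betw_imageI)
  show "inj_on list_order {L. distinct L \<and> set L = A \<and> r \<subseteq> list_order L}"
    by (auto intro!: inj_onI list_order_inj)
  have trancl: "r\<^sup>+ \<subseteq> s \<longleftrightarrow> r \<subseteq> s" if "linear_order_on A s" for s
  proof
    assume "r \<subseteq> s"
    then show "r\<^sup>+ \<subseteq> s"
      using that trancl_mono_subset[of r s] by (simp add: order_on_defs trancl_id)
  qed auto
  show "list_order ` {L. distinct L \<and> set L = A \<and> r \<subseteq> list_order L} = linear_extensions A (r\<^sup>+)"
  proof (intro equalityI subsetI)
    fix s assume "s \<in> list_order ` {L. distinct L \<and> set L = A \<and> r \<subseteq> list_order L}"
    then show "s \<in> linear_extensions A (r\<^sup>+)"
      using linear_order_on_list_order trancl unfolding linear_extensions_def by blast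
  next
    fix s assume "s \<in> linear_extensions A (r\<^sup>+)"
    then have s: "linear_order_on A s" "r \<subseteq> s"
      using trancl by (auto simp: linear_extensions_def)
    then show "s \<in> list_order ` {L. distinct L \<and> set L = A \<and> r \<subseteq> list_order L}"
      using linear_order_on_finite_list[OF assms s(1)] by blast
  qed
qed


section \<open>Numbering the occurrences of letters\<close>

text \<open>
  Meaningful only if \<open>a\<close> occurs in \<open>u\<close>; otherwise it says that \<open>b\<close> does not occur either.
\<close>

definition precedes :: "'a list \<Rightarrow> 'a \<Rightarrow> 'a \<Rightarrow> bool" where
  "precedes u a b \<longleftrightarrow> b \<notin> set (takeWhile (\<lambda>c. c \<noteq> a) u)"

lemma precedes_filter:
  assumes "P a" "P b"
  shows "precedes (filter P u) a b \<longleftrightarrow> precedes u a b"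
  unfolding precedes_def using assms by (induction u) auto

lemma precedes_map:
  assumes "inj_on f A" "set u \<subseteq> A" "a \<in> A" "b \<in> A"
  shows "precedes (map f u) (f a) (f b) \<longleftrightarrow> precedes u a b"
  unfolding precedes_def using assms(2) inj_on_eq_iff[OF assms(1)] assms(3,4)
  by (induction u) auto

text \<open>The recursion runs on the reversed word, where the tail holds the letters that come
  earlier in the original. This gives \<open>number\<close> its equation for appending a letter, on
  which the inductions rest.\<close>

fun number_rev :: "'a list \<Rightarrow> ('a \<times> nat) list" where
  "number_rev [] = []"
| "number_rev (a # u) = (a, Suc (count_list u a)) # number_rev u"

definition number :: "'a list \<Rightarrow> ('a \<times> nat) list" where
  "number u = rev (number_rev (rev u))"

lemma number_Nil [simp]: "number [] = []"
  by (simp add: number_def)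

lemma number_snoc [simp]: "number (u @ [a]) = number u @ [(a, Suc (count_list u a))]"
  by (simp add: number_def)

lemma map_fst_number: "map fst (number u) = u"
  by (induction u rule: rev_induct) auto

lemma set_number: "set (number u) = {(a, k). 1 \<le> k \<and> k \<le> count_list u a}"
proof (induction u rule: rev_induct)
  case (snoc a u)
  then show ?case
    by (auto split: if_splits)
qed auto

lemma distinct_number: "distinct (number u)"
  by (induction u rule: rev_induct) (auto simp: set_number)

lemma number_chains:
  assumes "(a, k) \<in> set (number u)" "(a, l) \<in> set (number u)" "k \<le> l"
  shows "((a, k), (a, l)) \<in> list_order (number u)"
  using assms by (induction u rule: rev_induct) (auto simp: list_order_snoc set_number)

lemma list_order_number_subset:
  "list_order (number u) \<subseteq> {(a, k). 1 \<le> k \<and> k \<le> count_list u a} \<times> {(a, k). 1 \<le> k \<and> k \<le> count_list u a}"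
  using list_order_subset[of "number u"] by (simp add: set_number)

text \<open>This yields surjectivity of the numbering. The last entry of \<open>L\<close> must be
  the top of its chain, since the top would otherwise have to come after it; removing it shortens
  that chain by one.\<close>

lemma number_unique:
  assumes "distinct L" "set L = {(a, k). 1 \<le> k \<and> k \<le> c a}"
    and "\<And>a k l. (a, k) \<in> set L \<Longrightarrow> (a, l) \<in> set L \<Longrightarrow> k \<le> l \<Longrightarrow> ((a, k), (a, l)) \<in> list_order L"
  shows "number (map fst L) = L \<and> count_list (map fst L) = c"
  using assms
proof (induction L arbitrary: c rule: rev_induct)
  case Nil
  \<comment> \<open>The empty list leaves no room for \<open>(a, c a)\<close>, which forces
    \<open>c\<close> to be zero everywhere.\<close>
  have "(a, c a) \<notin> {(a, k). 1 \<le> k \<and> k \<le> c a}" for a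
    unfolding Nil.prems(2)[symmetric] by simp
  then show ?case
    by (auto simp: fun_eq_iff Suc_le_eq)
next
  case (snoc p L)
  obtain a k where p: "p = (a, k)"
    by force
  have new: "p \<notin> set L"
    using snoc.prems(1) by simp
  have range: "1 \<le> k" "k \<le> c a"
    using snoc.prems(2) p by auto
  have "k = c a"
  proof (rule ccontr)
    assume "k \<noteq> c a"
    moreover have "(a, c a) \<in> set (L @ [p])"
      unfolding snoc.prems(2) using range by auto
    ultimately have "((a, k), (a, c a)) \<in> list_order L"
      using snoc.prems(3)[of a k "c a"] p range by (auto simp: list_order_snoc)
    then show False
      using list_order_subset[of L] new p by auto
  qed
  let ?d = "c(a := c a - 1)"
  have "set L = set (L @ [p]) - {p}"
    using new by auto
  also have "\<dots> = {(b, l). 1 \<le> l \<and> l \<le> ?d b}"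
    unfolding snoc.prems(2) using p \<open>k = c a\<close> by (auto split: if_splits)
  finally have setL: "set L = {(b, l). 1 \<le> l \<and> l \<le> ?d b}" .
  have "((b, l), (b, m)) \<in> list_order L" if "(b, l) \<in> set L" "(b, m) \<in> set L" "l \<le> m" for b l m
    using snoc.prems(3)[of b l m] that new by (auto simp: list_order_snoc)
  then have "number (map fst L) = L \<and> count_list (map fst L) = ?d"
    using snoc.IH[OF _ setL] snoc.prems(1) by auto
  then show ?case
    using p range \<open>k = c a\<close> by (auto simp: fun_eq_iff)
qed

text \<open>The entry \<open>(i, 1)\<close> marks the first occurrence of \<open>i\<close>.
  Appending a letter affects the comparison only if it is the first occurrence of \<open>i\<close>
  or of \<open>j\<close>.\<close>

lemma list_order_number_first:
  assumes "i \<in> set u" "j \<in> set u" "i \<noteq> j"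
  shows "((i, 1), (j, 1)) \<in> list_order (number u) \<longleftrightarrow> precedes u i j"
  using assms
proof (induction u rule: rev_induct)
  case (snoc a u)
  consider "i \<in> set u" "j \<in> set u" | "i \<in> set u" "j \<notin> set u" "a = j"
    | "i \<notin> set u" "j \<in> set u" "a = i"
    using snoc.prems by auto
  then show ?case
  proof cases
    case 1
    then have "(j, 1) \<noteq> (a, Suc (count_list u a))"
      by (auto simp: count_list_0_iff)
    then show ?thesis
      using 1 snoc by (auto simp: list_order_snoc precedes_def takeWhile_append)
  next
    case 2
    then have "(i, 1) \<in> set (number u)"
      by (simp add: set_number Suc_le_eq count_list_0_iff flip: neq0_conv)
    then show ?thesis
      using 2 by (auto simp: list_order_snoc precedes_def takeWhile_append dest: set_takeWhileD)
  next
    case 3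
    then show ?thesis
      using snoc.prems(3) list_order_number_subset[of u]
      by (auto simp: list_order_snoc precedes_def takeWhile_append)
  qed
qed simp

text \<open>The entry with the full count marks the last occurrence, which is the first one in the
  reversed word; hence \<open>i\<close> and \<open>j\<close> change places. Appending
  \<open>i\<close> or \<open>j\<close> settles the comparison at once, because that letter is now
  the latest.\<close>

lemma list_order_number_last:
  assumes "i \<in> set u" "j \<in> set u" "i \<noteq> j"
  shows "((i, count_list u i), (j, count_list u j)) \<in> list_order (number u) \<longleftrightarrow> precedes (rev u) j i"
  using assms
proof (induction u rule: rev_induct)
  case (snoc a u)
  consider "a = j" | "a = i" | "a \<noteq> i" "a \<noteq> j"
    by blast
  then show ?case
  proof cases
    case 1
    then have "(i, count_list u i) \<in> set (number u)"
      using snoc.prems by (simp add: set_number Suc_le_eq count_list_0_iff flip: neq0_conv)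
    then show ?thesis
      using 1 snoc.prems by (auto simp: list_order_snoc precedes_def)
  next
    case 2
    then show ?thesis
      using snoc.prems(3) list_order_number_subset[of u]
      by (auto simp: list_order_snoc precedes_def)
  next
    case 3
    then show ?thesis
      using snoc by (auto simp: list_order_snoc precedes_def)
  qed
qed simp


section \<open>The fibres of the insertion algorithm\<close>

text \<open>An existing root never moves: each letter raises its multiplicity or is passed to one
  side, and the two sides do not interact.\<close>

lemma fold_insert_letter_Node:
  "fold insert_letter w \<langle>l, (c, m), r\<rangle> =
     \<langle>fold insert_letter (filter (\<lambda>a. a < c) w) l, (c, m + count_list w c),
      fold insert_letter (filter (\<lambda>a. c < a) w) r\<rangle>"
  by (induction w arbitrary: l m r) auto

lemma P_lTg_Nil [simp]: "P_lTg [] = \<langle>\<rangle>"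
  by (simp add: P_lTg_def)

lemma P_lTg_Cons:
  "P_lTg (c # w) = \<langle>P_lTg (filter (\<lambda>a. a < c) w), (c, Suc (count_list w c)), P_lTg (filter (\<lambda>a. c < a) w)\<rangle>"
  by (simp add: P_lTg_def fold_insert_letter_Node)

lemma P_lTg_induct [case_names Nil Cons]:
  fixes P :: "nat list \<Rightarrow> bool"
  assumes "P []"
    and "\<And>c w. P (filter (\<lambda>a. a < c) w) \<Longrightarrow> P (filter (\<lambda>a. c < a) w) \<Longrightarrow> P (c # w)"
  shows "P w"
proof (induction w rule: length_induct)
  case (1 w)
  then show ?case
    using assms by (cases w) (auto simp: le_imp_less_Suc)
qed

lemma inorder_P_lTg:
  "set (map fst (inorder (P_lTg w))) = set w \<and> sorted_wrt (<) (map fst (inorder (P_lTg w)))"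
proof (induction w rule: P_lTg_induct)
  case (Cons c w)
  then show ?case
    by (auto simp: P_lTg_Cons sorted_wrt_append)
qed simp

text \<open>The \<open>i\<close>-th node thus carries the \<open>i\<close>-th letter of the support.
  This depends on \<open>w\<close> only through its set of letters, so the left and right trees
  number their nodes compatibly.\<close>

lemma map_fst_inorder_P_lTg:
  assumes "set x = set w" "sorted_wrt (<) x"
  shows "map fst (inorder (P_lTg w)) = x"
  using inorder_P_lTg[of w] assms by (intro strict_sorted_equal) simp_all

section \<open>Ancestry between letters and its description by node indices\<close>

definition addressed_nodes :: "('b \<times> 'c) tree \<Rightarrow> (bool list \<times> 'b) set" where
  "addressed_nodes T = set (zip (inorder_nodes T) (map fst (inorder T)))"

lemma length_inorder_nodes [simp]: "length (inorder_nodes T) = size T"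
  by (induction T) auto

lemma distinct_inorder_nodes: "distinct (inorder_nodes T)"
  by (induction T) (auto simp: distinct_map)

lemma addressed_nodes_Leaf [simp]: "addressed_nodes \<langle>\<rangle> = {}"
  by (simp add: addressed_nodes_def)

lemma addressed_nodes_Node:
  "addressed_nodes \<langle>l, (c, m), r\<rangle> =
     insert ([], c) (apfst ((#) False) ` addressed_nodes l \<union> apfst ((#) True) ` addressed_nodes r)"
  by (auto simp: addressed_nodes_def zip_append zip_map1 image_iff apfst_def map_prod_def)

lemma snd_addressed_nodes: "snd ` addressed_nodes T = set (map fst (inorder T))"
  by (simp add: addressed_nodes_def flip: set_map)

text \<open>Proper ancestry, transferred from addresses to letters so that it can be compared with
  occurrences in words. The existentials are nested so that one rule can unfold both in
  \<open>ancestors_Node\<close>.\<close>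

definition ancestors :: "('b \<times> 'c) tree \<Rightarrow> ('b \<times> 'b) set" where
  "ancestors T =
     {(a, b). \<exists>p. (p, a) \<in> addressed_nodes T \<and> (\<exists>q. (q, b) \<in> addressed_nodes T \<and> strict_prefix p q)}"

lemma ancestors_Leaf [simp]: "ancestors \<langle>\<rangle> = {}"
  by (simp add: ancestors_def)

text \<open>The root is above every other node, prepending a direction preserves the prefix order
  inside a subtree, and addresses starting with different directions are incomparable.\<close>

lemma ancestors_Node:
  "ancestors \<langle>l, (c, m), r\<rangle> =
     {c} \<times> (fst ` set (inorder l) \<union> fst ` set (inorder r)) \<union> ancestors l \<union> ancestors r"
proof -
  have ex: "(\<exists>p. (p, a) \<in> addressed_nodes \<langle>l, (c, m), r\<rangle> \<and> R p) \<longleftrightarrow> a = c \<and> R [] \<or>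
      (\<exists>p. (p, a) \<in> addressed_nodes l \<and> R (False # p)) \<or>
      (\<exists>p. (p, a) \<in> addressed_nodes r \<and> R (True # p))" for a R
    unfolding addressed_nodes_Node apfst_def map_prod_def by auto
  have letters: "fst ` set (inorder t) = {a. \<exists>p. (p, a) \<in> addressed_nodes t}" for t :: "('a \<times> 'b) tree"
    unfolding set_map[symmetric] snd_addressed_nodes[symmetric] by (auto simp: image_iff Bex_def)
  have "(a, b) \<in> ancestors \<langle>l, (c, m), r\<rangle> \<longleftrightarrow>
      a = c \<and> (\<exists>p. (p, b) \<in> addressed_nodes l \<or> (p, b) \<in> addressed_nodes r) \<or>
      (a, b) \<in> ancestors l \<or> (a, b) \<in> ancestors r" for a b
    by (simp add: ancestors_def ex ex_disj_distrib conj_disj_distribL disj_ac)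
  then show ?thesis
    unfolding letters by auto
qed

lemma ancestors_subset: "ancestors T \<subseteq> set (map fst (inorder T)) \<times> set (map fst (inorder T))"
  unfolding ancestors_def snd_addressed_nodes[symmetric] by (auto simp: image_iff Bex_def)

lemma ancestors_Delta:
  assumes "x = map fst (inorder T)"
  shows "ancestors T = {(x ! (i - 1), x ! (j - 1)) | i j. (i, j) \<in> Delta T \<and> i \<noteq> j}"
proof -
  have nodes: "(p, a) \<in> addressed_nodes T \<longleftrightarrow> (\<exists>i \<in> {1..size T}. p = ith_node T i \<and> a = x ! (i - 1))" for p a
  proof -
    have "(p, a) \<in> addressed_nodes T \<longleftrightarrow> (\<exists>n < size T. p = inorder_nodes T ! n \<and> a = x ! n)"
      by (auto simp: addressed_nodes_def set_zip assms)
    also have "\<dots> \<longleftrightarrow> (\<exists>i \<in> {1..size T}. p = ith_node T i \<and> a = x ! (i - 1))"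
      unfolding ith_node_def by (metis One_nat_def Suc_le_eq Suc_pred atLeastAtMost_iff diff_Suc_1 le_numeral_extra(4) less_eq_Suc_le zero_less_Suc)
    finally show ?thesis .
  qed
  \<comment> \<open>Addresses are distinct, so \<open>i \<noteq> j\<close> amounts to strictness of
    the prefix. Subtraction truncates, so \<open>i - 1\<close> determines \<open>i\<close> only
    because indices start at 1.\<close>
  have inj: "ith_node T i = ith_node T j \<longleftrightarrow> i = j" if "i \<in> {1..size T}" "j \<in> {1..size T}" for i j
    using that nth_eq_iff_index_eq[OF distinct_inorder_nodes, of "i - 1" T "j - 1"]
    by (simp add: ith_node_def) linarith
  show ?thesis
  proof (intro equalityI subrelI)
    fix a b assume "(a, b) \<in> ancestors T"
    then obtain i j where "i \<in> {1..size T}" "j \<in> {1..size T}"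
      and eq: "a = x ! (i - 1)" "b = x ! (j - 1)" and "strict_prefix (ith_node T i) (ith_node T j)"
      unfolding ancestors_def nodes by blast
    then have "(i, j) \<in> Delta T" "i \<noteq> j"
      by (auto simp: Delta_def)
    with eq show "(a, b) \<in> {(x ! (i - 1), x ! (j - 1)) | i j. (i, j) \<in> Delta T \<and> i \<noteq> j}"
      by blast
  next
    fix a b assume "(a, b) \<in> {(x ! (i - 1), x ! (j - 1)) | i j. (i, j) \<in> Delta T \<and> i \<noteq> j}"
    then obtain i j where ij: "i \<in> {1..size T}" "j \<in> {1..size T}" "i \<noteq> j"
      and eq: "a = x ! (i - 1)" "b = x ! (j - 1)" and "prefix (ith_node T i) (ith_node T j)"
      unfolding Delta_def by blast
    then have "strict_prefix (ith_node T i) (ith_node T j)"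
      using inj by (simp add: strict_prefix_def)
    with ij eq show "(a, b) \<in> ancestors T"
      unfolding ancestors_def nodes by blast
  qed
qed

lemma Nabla_eq: "Nabla T = (Delta T)\<inverse>"
  by (auto simp: Nabla_def Delta_def)

section \<open>Words with a prescribed tree\<close>

lemma count_list_filter: "count_list (filter P u) a = (if P a then count_list u a else 0)"
  by (induction u) auto

lemma count_list_eq_split:
  fixes c :: "'a :: linorder"
  shows "count_list u = count_list w \<longleftrightarrow>
     count_list (filter (\<lambda>a. a < c) u) = count_list (filter (\<lambda>a. a < c) w) \<and>
     count_list u c = count_list w c \<and>
     count_list (filter (\<lambda>a. c < a) u) = count_list (filter (\<lambda>a. c < a) w)"
proof (intro iffI ext)
  fix a assume eq: "count_list (filter (\<lambda>a. a < c) u) = count_list (filter (\<lambda>a. a < c) w) \<and>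
     count_list u c = count_list w c \<and>
     count_list (filter (\<lambda>a. c < a) u) = count_list (filter (\<lambda>a. c < a) w)"
  consider "a < c" | "a = c" | "c < a"
    by (rule linorder_cases)
  then show "count_list u a = count_list w a"
    using eq[unfolded fun_eq_iff count_list_filter] by cases (auto dest: spec[of _ a])
qed (simp add: fun_eq_iff count_list_filter)

text \<open>For words of equal content, the constraints from the root \<open>c\<close> say exactly
  that \<open>u\<close> starts with \<open>c\<close>. All other constraints stay within one subtree
  and concern only the subword of letters on that side of \<open>c\<close>.\<close>

lemma P_lTg_eq_iff:
  "P_lTg u = P_lTg w \<longleftrightarrow>
     count_list u = count_list w \<and> (\<forall>(a, b) \<in> ancestors (P_lTg w). precedes u a b)"
proof (induction w arbitrary: u rule: P_lTg_induct)
  case Nil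
  show ?case
    by (cases u) (auto simp: P_lTg_Cons fun_eq_iff)
next
  case (Cons c w)
  let ?l = "filter (\<lambda>a. a < c)" and ?r = "filter (\<lambda>a. c < a)"
  have anc: "ancestors (P_lTg (c # w)) =
      {c} \<times> {a \<in> set w. a \<noteq> c} \<union> ancestors (P_lTg (?l w)) \<union> ancestors (P_lTg (?r w))"
    using inorder_P_lTg[of "?l w"] inorder_P_lTg[of "?r w"]
    unfolding P_lTg_Cons ancestors_Node by auto
  consider "u = []" | d u' where "u = d # u'" "d \<noteq> c" | u' where "u = c # u'"
    by (cases u) auto
  then show ?case
  proof cases
    case 1
    then show ?thesis
      by (auto simp: P_lTg_Cons fun_eq_iff)
  next
    case 2
    \<comment> \<open>A first letter \<open>d\<close> other than \<open>c\<close> would be a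
      descendant of the root \<open>c\<close> that occurs before it.\<close>
    have False if "count_list u = count_list (c # w)" "\<forall>(a, b) \<in> ancestors (P_lTg (c # w)). precedes u a b"
    proof -
      have "count_list (c # w) d \<noteq> 0"
        unfolding that(1)[symmetric] using 2 by simp
      then have "d \<in> set w"
        using 2 by (auto simp: count_list_0_iff split: if_splits)
      then have "(c, d) \<in> ancestors (P_lTg (c # w))"
        using 2 unfolding anc by simp
      then have "precedes u c d"
        using that(2) by blast
      then show False
        using 2 by (simp add: precedes_def)
    qed
    moreover have "P_lTg u \<noteq> P_lTg (c # w)"
      using 2 by (simp add: P_lTg_Cons)
    ultimately show ?thesis
      by blast
  next
    case 3
    have "precedes u c b" for b
      using 3 by (simp add: precedes_def)
    \<comment> \<open>The leading \<open>c\<close> is filtered out, so \<open>?l u'\<close> is also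
      the filtered form of \<open>u\<close> itself.\<close>
    moreover have "precedes (?l u') a b \<longleftrightarrow> precedes u a b" if "(a, b) \<in> ancestors (P_lTg (?l w))" for a b
    proof -
      have "a < c" "b < c"
        using that ancestors_subset[of "P_lTg (?l w)"] inorder_P_lTg[of "?l w"] by auto
      then show ?thesis
        using precedes_filter[of "\<lambda>a. a < c" a b u] 3 by simp
    qed
    moreover have "precedes (?r u') a b \<longleftrightarrow> precedes u a b" if "(a, b) \<in> ancestors (P_lTg (?r w))" for a b
    proof -
      have "c < a" "c < b"
        using that ancestors_subset[of "P_lTg (?r w)"] inorder_P_lTg[of "?r w"] by auto
      then show ?thesis
        using precedes_filter[of "\<lambda>a. c < a" a b u] 3 by simp
    qed
    ultimately have "(\<forall>(a, b) \<in> ancestors (P_lTg (c # w)). precedes u a b) \<longleftrightarrow>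
        (\<forall>(a, b) \<in> ancestors (P_lTg (?l w)). precedes (?l u') a b) \<and>
        (\<forall>(a, b) \<in> ancestors (P_lTg (?r w)). precedes (?r u') a b)"
      unfolding anc ball_Un by (simp add: case_prod_beta)
    moreover have "P_lTg u = P_lTg (c # w) \<longleftrightarrow>
        P_lTg (?l u') = P_lTg (?l w) \<and> count_list u' c = count_list w c \<and> P_lTg (?r u') = P_lTg (?r w)"
      using 3 by (auto simp: P_lTg_Cons)
    moreover have "count_list u = count_list (c # w) \<longleftrightarrow> count_list (?l u') = count_list (?l w) \<and>
        count_list u' c = count_list w c \<and> count_list (?r u') = count_list (?r w)"
      unfolding 3 count_list_eq_split[of "c # u'" "c # w" c] by simp
    ultimately show ?thesis
      unfolding Cons.IH by (simp only: conj_ac)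
  qed
qed

lemma mTg_class_iff:
  assumes "w \<in> words" "P_mTg w = (TL, TR)"
  shows "u \<in> mTg_class w \<longleftrightarrow> count_list u = count_list w \<and>
     (\<forall>(a, b) \<in> ancestors TL. precedes u a b) \<and> (\<forall>(a, b) \<in> ancestors TR. precedes (rev u) a b)"
proof -
  \<comment> \<open>Equal content means equal support, so the positivity of the letters carries over
    from \<open>w\<close>.\<close>
  have "u \<in> words" if "count_list u = count_list w"
  proof -
    have "set u = set w"
      using that by (metis count_list_0_iff subsetI subset_antisym)
    then show ?thesis
      using assms(1) by auto
  qed
  moreover have "u \<in> mTg_class w \<longleftrightarrow> u \<in> words \<and> P_lTg u = P_lTg w \<and> P_lTg (rev u) = P_lTg (rev w)"
    using assms(1) by (auto simp: mTg_class_def mTg_cong_def P_mTg_def P_rTg_def P_lTg_def)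
  moreover have "TL = P_lTg w" "TR = P_lTg (rev w)"
    using assms(2) by (auto simp: P_mTg_def P_rTg_def P_lTg_def)
  ultimately show ?thesis
    using P_lTg_eq_iff[of u w] P_lTg_eq_iff[of "rev u" "rev w"] by (auto simp: fun_eq_iff)
qed


section \<open>The bijection\<close>

lemma count_list_map_inj_on:
  assumes "inj_on f A" "set u \<subseteq> A" "a \<in> A"
  shows "count_list (map f u) (f a) = count_list u a"
  using assms(2) inj_on_eq_iff[OF assms(1)] assms(3) by (induction u) auto

text \<open>The link between the class and the poset: letters are replaced by their ranks, so that
  numbering such a word produces elements of \<open>Q_carrier\<close> directly.\<close>

definition index_words :: "(nat \<Rightarrow> nat) \<Rightarrow> 'a tree \<Rightarrow> 'b tree \<Rightarrow> nat list set" where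
  "index_words c TL TR = {N. count_list N = c \<and>
     (\<forall>i j. (i, j) \<in> Delta TL \<and> i \<noteq> j \<longrightarrow> precedes N i j) \<and>
     (\<forall>i j. (i, j) \<in> Delta TR \<and> i \<noteq> j \<longrightarrow> precedes (rev N) i j)}"

text \<open>Numbering identifies index words with the listings of the poset that respect its
  generating relations: chains hold automatically, and the trees give the conditions on first and
  last occurrences.\<close>

lemma bij_betw_linear_extensions_Q:
  assumes "size TL = length X" "size TR = length X" "\<forall>m \<in> set X. 1 \<le> m"
    and c: "c = (\<lambda>i. if i \<in> {1..length X} then X ! (i - 1) else 0)"
  shows "bij_betw (list_order \<circ> number) (index_words c TL TR)
           (linear_extensions (Q_carrier X) (Q_order X TL TR))"
proof -
  let ?D = "{((i, 1), (j, 1)) | i j. (i, j) \<in> Delta TL \<and> i \<noteq> j}"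
  let ?N = "{((i, X ! (i - 1)), (j, X ! (j - 1))) | i j. (i, j) \<in> Nabla TR \<and> i \<noteq> j}"
  let ?G = "Q_chains X \<union> ?D \<union> ?N"
  let ?L = "{L. distinct L \<and> set L = Q_carrier X \<and> ?G \<subseteq> list_order L}"
  \<comment> \<open>The default value 0 of \<open>c\<close> off the index range excludes stray
    chains.\<close>
  have Q: "Q_carrier X = {(i, a). 1 \<le> a \<and> a \<le> c i}"
    by (auto simp: Q_carrier_def c split: if_splits)
  have c_pos: "c i = X ! (i - 1)" "0 < c i" if "i \<in> {1..length X}" for i
  proof -
    show "c i = X ! (i - 1)"
      using that c by simp
    moreover have "X ! (i - 1) \<in> set X"
      using that by (intro nth_mem) auto
    ultimately show "0 < c i"
      using assms(3) by (auto simp: Suc_le_eq)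
  qed
  have number: "number N \<in> ?L \<longleftrightarrow> N \<in> index_words c TL TR" if N: "count_list N = c" for N
  proof -
    have set: "set (number N) = Q_carrier X"
      by (simp add: set_number N Q)
    \<comment> \<open>Positive multiplicities make every index occur, so \<open>precedes\<close>
      really compares occurrences.\<close>
    have mem: "i \<in> set N" if "i \<in> {1..length X}" for i
      using c_pos(2)[OF that] by (metis N count_list_0_iff less_irrefl)
    have "Q_chains X \<subseteq> list_order (number N)"
      using number_chains[of _ _ N] unfolding set by (auto simp: Q_chains_def)
    moreover have "?D \<subseteq> list_order (number N) \<longleftrightarrow> (\<forall>i j. (i, j) \<in> Delta TL \<and> i \<noteq> j \<longrightarrow> precedes N i j)"
    proof -
      have "((i, 1), (j, 1)) \<in> list_order (number N) \<longleftrightarrow> precedes N i j"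
        if "(i, j) \<in> Delta TL" "i \<noteq> j" for i j
        using that mem by (intro list_order_number_first) (auto simp: Delta_def assms(1))
      then show ?thesis
        by blast
    qed
    moreover have "?N \<subseteq> list_order (number N) \<longleftrightarrow> (\<forall>i j. (i, j) \<in> Delta TR \<and> i \<noteq> j \<longrightarrow> precedes (rev N) i j)"
    proof -
      \<comment> \<open>The indices are swapped because \<open>Nabla\<close> is the converse of
        \<open>Delta\<close>: an ancestor in the right tree has the later last occurrence.\<close>
      have "((j, X ! (j - 1)), (i, X ! (i - 1))) \<in> list_order (number N) \<longleftrightarrow> precedes (rev N) i j"
        if "(i, j) \<in> Delta TR" "i \<noteq> j" for i j
      proof -
        have "i \<in> {1..length X}" "j \<in> {1..length X}"
          using that by (auto simp: Delta_def assms(2))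
        then show ?thesis
          using list_order_number_last[of j N i] mem that by (simp add: N c_pos)
      qed
      then show ?thesis
        unfolding Nabla_eq by blast
    qed
    ultimately show ?thesis
      using N set distinct_number[of N] by (simp add: index_words_def)
  qed
  have "L \<in> number ` index_words c TL TR" if L: "L \<in> ?L" for L
  proof -
    have "((a, k), (a, l)) \<in> list_order L" if "(a, k) \<in> set L" "(a, l) \<in> set L" "k \<le> l" for a k l
      using that L by (auto simp: Q_chains_def)
    then have "number (map fst L) = L" "count_list (map fst L) = c"
      using number_unique[of L c] L Q by auto
    then show ?thesis
      using number[of "map fst L"] L by (metis (no_types, lifting) image_eqI)
  qed
  moreover have "number ` index_words c TL TR \<subseteq> ?L"
  proof (rule image_subsetI)
    fix N assume "N \<in> index_words c TL TR"
    then show "number N \<in> ?L"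
      using number[of N] unfolding index_words_def by blast
  qed
  moreover have "inj_on number (index_words c TL TR)"
    by (metis inj_onI map_fst_number)
  ultimately have "bij_betw number (index_words c TL TR) ?L"
    by (intro bij_betw_imageI) blast+
  moreover have "finite (Q_carrier X)"
  proof -
    have "Q_carrier X = (SIGMA i:{1..length X}. {1..X ! (i - 1)})"
      by (auto simp: Q_carrier_def)
    then show ?thesis
      by simp
  qed
  ultimately show ?thesis
    unfolding Q_order_def using bij_betw_list_order bij_betw_trans by blast
qed

text \<open>Replacing each rank by its letter is injective on the index range, so it preserves
  counts and the order of occurrences, while inorder numbering matches ancestry of letters with
  \<open>Delta\<close>.\<close>

lemma bij_betw_mTg_class:
  assumes "w \<in> words" "P_mTg w = (TL, TR)"
    and "set x = set w" "sorted_wrt (<) x" "X = map (count_list w) x"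
    and c: "c = (\<lambda>i. if i \<in> {1..length X} then X ! (i - 1) else 0)"
  shows "bij_betw (map (\<lambda>i. x ! (i - 1))) (index_words c TL TR) (mTg_class w)"
proof -
  let ?I = "{1..length X}" and ?x = "\<lambda>i. x ! (i - 1)"
  have len: "length X = length x"
    using assms(5) by simp
  have "distinct x"
    using assms(4) strict_sorted_iff by blast
  then have inj: "inj_on ?x ?I"
    by (auto simp: inj_on_def nth_eq_iff_index_eq len)
  have img: "?x ` ?I = set x"
  proof (intro equalityI subsetI)
    fix a assume "a \<in> set x"
    then obtain n where "n < length x" "a = ?x (Suc n)"
      by (auto simp: set_conv_nth)
    then show "a \<in> ?x ` ?I"
      by (intro image_eqI[of _ _ "Suc n"]) (simp_all add: len)
  qed (auto simp: len)
  have c_eq: "c i = count_list w (?x i)" if "i \<in> ?I" for i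
    using that by (auto simp: c assms(5))
  have TL: "TL = P_lTg w" and TR: "TR = P_lTg (rev w)"
    using assms(2) by (auto simp: P_mTg_def P_rTg_def P_lTg_def)
  have x: "x = map fst (inorder TL)" "x = map fst (inorder TR)"
    using assms(3,4) by (simp_all add: TL TR map_fst_inorder_P_lTg)
  have Delta: "Delta TL \<subseteq> ?I \<times> ?I" "Delta TR \<subseteq> ?I \<times> ?I"
    using x[THEN arg_cong, of length] by (auto simp: Delta_def len)
  have iff: "map ?x N \<in> mTg_class w \<longleftrightarrow> N \<in> index_words c TL TR" if N: "set N \<subseteq> ?I" for N
  proof -
    have count: "count_list (map ?x N) (?x i) = count_list N i" if "i \<in> ?I" for i
      using count_list_map_inj_on[OF inj N that] .
    have "count_list (map ?x N) = count_list w \<longleftrightarrow> count_list N = c"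
    proof (intro iffI ext)
      \<comment> \<open>Off \<open>?I\<close> both sides vanish: \<open>N\<close> has no such
        letter, and \<open>c\<close> is 0 there.\<close>
      fix i assume "count_list (map ?x N) = count_list w"
      then show "count_list N i = c i"
        using count[of i] c_eq[of i] N
        by (cases "i \<in> ?I") (auto simp: c intro!: count_notin)
    next
      fix a assume eq: "count_list N = c"
      show "count_list (map ?x N) a = count_list w a"
      proof (cases "a \<in> set x")
        case True
        then obtain i where "i \<in> ?I" "a = ?x i"
          using img by blast
        then show ?thesis
          using count c_eq eq by simp
      next
        case False
        then have "a \<notin> set (map ?x N)"
          using N img by auto
        with False show ?thesis
          using assms(3) by (metis count_notin)
      qed
    qed
    moreover have "(\<forall>(a, b) \<in> ancestors TL. precedes (map ?x N) a b) \<longleftrightarrow>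
        (\<forall>i j. (i, j) \<in> Delta TL \<and> i \<noteq> j \<longrightarrow> precedes N i j)"
    proof -
      have "precedes (map ?x N) (?x i) (?x j) \<longleftrightarrow> precedes N i j" if "(i, j) \<in> Delta TL" for i j
        using that Delta precedes_map[OF inj N] by blast
      then show ?thesis
        unfolding ancestors_Delta[OF x(1)] by blast
    qed
    moreover have "(\<forall>(a, b) \<in> ancestors TR. precedes (rev (map ?x N)) a b) \<longleftrightarrow>
        (\<forall>i j. (i, j) \<in> Delta TR \<and> i \<noteq> j \<longrightarrow> precedes (rev N) i j)"
    proof -
      have "precedes (rev (map ?x N)) (?x i) (?x j) \<longleftrightarrow> precedes (rev N) i j" if "(i, j) \<in> Delta TR" for i j
        using that Delta precedes_map[OF inj, of "rev N"] N by (auto simp: rev_map)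
      then show ?thesis
        unfolding ancestors_Delta[OF x(2)] by blast
    qed
    ultimately show ?thesis
      unfolding mTg_class_iff[OF assms(1,2)] by (simp add: index_words_def)
  qed
  have I: "set N \<subseteq> ?I" if "N \<in> index_words c TL TR" for N
  proof
    fix i assume "i \<in> set N"
    then have "c i \<noteq> 0"
      using that unfolding index_words_def by (metis (mono_tags, lifting) count_list_0_iff mem_Collect_eq)
    then show "i \<in> ?I"
      by (auto simp: c split: if_splits)
  qed
  have "u \<in> map ?x ` index_words c TL TR" if u: "u \<in> mTg_class w" for u
  proof -
    have "count_list u = count_list w"
      using u mTg_class_iff[OF assms(1,2)] by blast
    \<comment> \<open>All letters of \<open>u\<close> lie in the support, so \<open>u\<close> can be
      pulled back to a word of ranks.\<close>
    then have "set u \<subseteq> ?x ` ?I"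
      unfolding img assms(3) by (metis count_list_0_iff subsetI)
    then have "u \<in> map ?x ` lists ?I"
      unfolding lists_image[symmetric] by (simp add: in_lists_conv_set subset_eq)
    then obtain N where "set N \<subseteq> ?I" "u = map ?x N"
      by (auto simp: in_lists_conv_set)
    then show ?thesis
      using iff u by blast
  qed
  moreover have "inj_on (map ?x) (index_words c TL TR)"
  proof (rule inj_onI)
    fix M N assume *: "M \<in> index_words c TL TR" "N \<in> index_words c TL TR" "map ?x M = map ?x N"
    have "inj_on ?x (set M \<union> set N)"
      using I[OF *(1)] I[OF *(2)] by (intro inj_on_subset[OF inj]) simp
    with *(3) show "M = N"
      by (rule map_inj_on)
  qed
  moreover have "map ?x N \<in> mTg_class w" if "N \<in> index_words c TL TR" for N
    using iff[OF I[OF that]] that by simp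
  ultimately show ?thesis
    by (intro bij_betw_imageI) blast+
qed

theorem proposition5p8:
  fixes w x X :: "nat list" and TL TR :: bstm
  assumes "w \<in> words"
    and "(TL, TR) = P_mTg w"
    and "set x = set w" and "sorted_wrt (<) x"
    and "X = map (count_list w) x"
  shows "\<exists>f. bij_betw f (mTg_class w) (linear_extensions (Q_carrier X) (Q_order X TL TR))"
proof -
  define c where "c = (\<lambda>i. if i \<in> {1..length X} then X ! (i - 1) else 0)"
  have P: "P_mTg w = (TL, TR)"
    using assms(2) by simp
  have "map fst (inorder TL) = x" "map fst (inorder TR) = x"
    using map_fst_inorder_P_lTg[of x w] map_fst_inorder_P_lTg[of x "rev w"] P assms(3,4)
    by (simp_all add: P_mTg_def P_rTg_def P_lTg_def)
  then have "size TL = length X" "size TR = length X"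
    using assms(5) by (metis length_inorder length_map)+
  moreover have "\<forall>m \<in> set X. 1 \<le> m"
    using assms(3,5) by (auto simp: Suc_le_eq count_list_0_iff simp flip: neq0_conv)
  ultimately have "bij_betw (list_order \<circ> number) (index_words c TL TR)
      (linear_extensions (Q_carrier X) (Q_order X TL TR))"
    using c_def by (rule bij_betw_linear_extensions_Q)
  \<comment> \<open>The bijection renames letters to ranks by inverting the relabelling, numbers the
    occurrences, and reads the resulting list as a linear order.\<close>
  with bij_betw_inv_into[OF bij_betw_mTg_class[OF assms(1) P assms(3-5) c_def]] show ?thesis
    by (intro exI) (rule bij_betw_trans)
qed

end
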